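(* Let $G_0$, $G$, $H$ be graphs such that $G$ is a region intersection graph over $G_0$, and let $\dot H$ be the graph obtained from $H$ by subdividing every edge into a path of length two. If $\dot H$ is a strict minor of $G$, then $H$ is a minor of $G_0$.
   Context: All graphs are finite, undirected and simple; $V_G,E_G$ denote the vertex and edge sets, and $E_G(A,B)$ the set of edges with one endpoint in $A$ and the other in $B$. $G$ is a region intersection graph (rig) over $G_0$ if there are nonempty subsets $\{R_u\subseteq V_{G_0}:u\in V_G\}$, each inducing a connected subgraph of $G_0$, such that for distinct $u,v\in V_G$: $\{u,v\}\in E_G\iff R_u\cap R_v\neq\emptyset$. $H$ is a minor of $G$ if there are pairwise disjoint nonempty connected subsets $\{A_u\subseteq V_G:u\in V_H\}$ such that $\{u,v\}\in E_H\Rightarrow E_G(A_u,A_v)\neq\emptyset$. $H$ is a strict minor of $G$ if such sets can be chosen so that for distinct $u,v\in V_H$ the stronger condition $\{u,v\}\in E_H\iff E_G(A_u,A_v)\ne\emptyset$ holds (equivalently, $H$ can be obtained from $G$ by edge contractions and vertex deletions only). *)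

theory Defs
  imports "Graph_Theory.Digraph_Component"
begin

text \<open>
  Finite simple undirected graphs are the library's \<open>pair_graph\<close>s: finite, loop-free digraphs with
  arcs in \<open>'a \<times> 'a\<close>, where an undirected edge \<open>{u, v}\<close> is represented by the two opposite arcs
  \<open>(u, v)\<close> and \<open>(v, u)\<close>.
\<close>

definition uedges :: "'a pair_pre_digraph \<Rightarrow> 'a set set" where
  "uedges G = {{u, v} | u v. (u, v) \<in> parcs G}"

definition uedges_between :: "'a pair_pre_digraph \<Rightarrow> 'a set \<Rightarrow> 'a set \<Rightarrow> 'a set set" where
  "uedges_between G A B = {{a, b} | a b. a \<in> A \<and> b \<in> B \<and> {a, b} \<in> uedges G}"

text \<open>
  The inclusion in \<open>pverts G\<close> has to be required separately, since \<open>G \<restriction> A\<close> has vertex set \<open>A\<close>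
  for arbitrary \<open>A\<close>. The library's \<open>connected\<close> already excludes \<open>A = {}\<close>.
\<close>

definition connected_set :: "'a pair_pre_digraph \<Rightarrow> 'a set \<Rightarrow> bool" where
  "connected_set G A \<longleftrightarrow> A \<subseteq> pverts G \<and> A \<noteq> {} \<and> Digraph_Component.connected (with_proj G \<restriction> A)"

definition region_intersection_graph :: "'a pair_pre_digraph \<Rightarrow> 'b pair_pre_digraph \<Rightarrow> bool" where
  "region_intersection_graph G G0 \<longleftrightarrow>
     (\<exists>R. (\<forall>u \<in> pverts G. connected_set G0 (R u)) \<and>
          (\<forall>u \<in> pverts G. \<forall>v \<in> pverts G. u \<noteq> v \<longrightarrow>
             ({u, v} \<in> uedges G \<longleftrightarrow> R u \<inter> R v \<noteq> {})))"

definition is_minor :: "'a pair_pre_digraph \<Rightarrow> 'b pair_pre_digraph \<Rightarrow> bool" where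
  "is_minor H G \<longleftrightarrow>
     (\<exists>A. (\<forall>u \<in> pverts H. connected_set G (A u)) \<and>
          (\<forall>u \<in> pverts H. \<forall>v \<in> pverts H. u \<noteq> v \<longrightarrow> A u \<inter> A v = {}) \<and>
          (\<forall>u \<in> pverts H. \<forall>v \<in> pverts H.
             {u, v} \<in> uedges H \<longrightarrow> uedges_between G (A u) (A v) \<noteq> {}))"

definition is_strict_minor :: "'a pair_pre_digraph \<Rightarrow> 'b pair_pre_digraph \<Rightarrow> bool" where
  "is_strict_minor H G \<longleftrightarrow>
     (\<exists>A. (\<forall>u \<in> pverts H. connected_set G (A u)) \<and>
          (\<forall>u \<in> pverts H. \<forall>v \<in> pverts H. u \<noteq> v \<longrightarrow> A u \<inter> A v = {}) \<and>
          (\<forall>u \<in> pverts H. \<forall>v \<in> pverts H. u \<noteq> v \<longrightarrow>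
             ({u, v} \<in> uedges H \<longleftrightarrow> uedges_between G (A u) (A v) \<noteq> {})))"

text \<open>
  In the 1-subdivision, \<open>Inl u\<close> is the original vertex \<open>u\<close> and \<open>Inr e\<close> is the new vertex in the
  middle of the edge \<open>e\<close>.
\<close>

definition subdivide_edges :: "'a pair_pre_digraph \<Rightarrow> ('a + 'a set) pair_pre_digraph" where
  "subdivide_edges H =
     \<lparr> pverts = Inl ` pverts H \<union> Inr ` uedges H,
       parcs = {(Inl u, Inr e) | u e. e \<in> uedges H \<and> u \<in> e} \<union>
               {(Inr e, Inl u) | u e. e \<in> uedges H \<and> u \<in> e} \<rparr>"

lemma pair_graph_subdivide_edges:
  assumes "pair_graph H"
  shows "pair_graph (subdivide_edges H)"
proof -
  interpret H: pair_graph H by (rule assms)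
  have "uedges H = (\<lambda>(u, v). {u, v}) ` parcs H"
    by (auto simp: uedges_def)
  then have fin_edges: "finite (uedges H)"
    by simp
  have verts: "u \<in> pverts H" if "e \<in> uedges H" "u \<in> e" for u e
    using that by (auto simp: uedges_def dest: H.wellformed')
  have fin_verts: "finite (pverts (subdivide_edges H))"
    using fin_edges by (simp add: subdivide_edges_def)
  have arcs: "parcs (subdivide_edges H) \<subseteq>
      pverts (subdivide_edges H) \<times> pverts (subdivide_edges H)"
    using verts by (auto simp: subdivide_edges_def)
  then have "finite (parcs (subdivide_edges H))"
    using fin_verts by (meson finite_SigmaI finite_subset)
  moreover have "symmetric (with_proj (subdivide_edges H))"
    unfolding symmetric_def by (auto simp: subdivide_edges_def intro!: symI)
  ultimately show ?thesis
    using fin_verts arcs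
    by unfold_locales (auto simp: subdivide_edges_def dest: verts)
qed

end

(*
  Replace each branch set of the subdivision by the union of its regions. Strictness says that two
  of these connected unions meet exactly when one belongs to an original vertex u and the other to
  an edge e containing u. For e = {u, v} it remains to trim the union of e to a connected piece that
  meets the union of u, avoids that of v, and is adjacent to it; this piece is absorbed into u.
*)
theory Submission
  imports Defs
begin

lemma doubleton_in_uedges_iff: "{x, y} \<in> uedges G \<longleftrightarrow> (x, y) \<in> parcs G \<or> (y, x) \<in> parcs G"
  by (auto simp: uedges_def doubleton_eq_iff)

text \<open>The vertices of \<open>A\<close> reachable from a fixed vertex form an edge-closed
  subset, and any edge-closed subset containing that vertex contains all of them. This turns
  connectivity into a closure principle, so that walks never appear again.\<close>

lemma connected_set_iff_closed_subsets:
  "connected_set G A \<longleftrightarrow> A \<subseteq> pverts G \<and> A \<noteq> {} \<and>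
     (\<forall>S \<subseteq> A. S \<noteq> {} \<longrightarrow> (\<forall>x \<in> S. \<forall>y \<in> A. {x, y} \<in> uedges G \<longrightarrow> y \<in> S) \<longrightarrow> S = A)"
proof -
  define r where "r = {(x, y). x \<in> A \<and> y \<in> A \<and> {x, y} \<in> uedges G}"
  \<comment> \<open>Both sides forget orientation: the library's connectedness is reachability in
    the symmetric closure of the arcs, and \<open>uedges\<close> consists of unordered
    pairs.\<close>
  have "(arcs_ends (with_proj G \<restriction> A))\<^sup>s = r"
    by (auto simp: r_def symcl_def arcs_ends_conv doubleton_in_uedges_iff image_iff)
  then have "connected_set G A \<longleftrightarrow>
      A \<subseteq> pverts G \<and> A \<noteq> {} \<and> (\<forall>u \<in> A. \<forall>v \<in> A. (u, v) \<in> rtrancl_on A r)"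
    by (auto simp: connected_set_def connected_conv)
  moreover have "(\<forall>u \<in> A. \<forall>v \<in> A. (u, v) \<in> rtrancl_on A r) \<longleftrightarrow>
      (\<forall>S \<subseteq> A. S \<noteq> {} \<longrightarrow> (\<forall>x \<in> S. \<forall>y \<in> A. {x, y} \<in> uedges G \<longrightarrow> y \<in> S) \<longrightarrow> S = A)"
    (is "?reach \<longleftrightarrow> ?closed")
  proof
    assume reach: ?reach
    show ?closed
    proof (intro allI impI)
      fix S
      assume S: "S \<subseteq> A" "S \<noteq> {}" "\<forall>x \<in> S. \<forall>y \<in> A. {x, y} \<in> uedges G \<longrightarrow> y \<in> S"
      then obtain u where u: "u \<in> S"
        by blast
      have "v \<in> S" if "(u, v) \<in> rtrancl_on A r" for v
        using that
      proof (induct rule: rtrancl_on_induct)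
        case base
        show ?case
          by (rule u)
      next
        case (step y z)
        then show ?case
          using S(3) by (auto simp: r_def)
      qed
      with reach u S(1) show "S = A"
        by blast
    qed
  next
    assume closed: ?closed
    show ?reach
    proof (intro ballI)
      fix u v
      assume u: "u \<in> A" and v: "v \<in> A"
      let ?S = "{w \<in> A. (u, w) \<in> rtrancl_on A r}"
      have "\<forall>x \<in> ?S. \<forall>y \<in> A. {x, y} \<in> uedges G \<longrightarrow> y \<in> ?S"
        by (auto simp: r_def intro: rtrancl_on_into_rtrancl_on)
      moreover have "u \<in> ?S"
        using u by simp
      ultimately have "?S = A"
        using closed by blast
      with v show "(u, v) \<in> rtrancl_on A r"
        by blast
    qed
  qed
  ultimately show ?thesis
    by simp
qed

lemma connected_setI:
  assumes "A \<subseteq> pverts G" and "A \<noteq> {}"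
    and "\<And>S. \<lbrakk>S \<subseteq> A; S \<noteq> {}; \<And>x y. \<lbrakk>x \<in> S; y \<in> A; {x, y} \<in> uedges G\<rbrakk> \<Longrightarrow> y \<in> S\<rbrakk> \<Longrightarrow> A \<subseteq> S"
  shows "connected_set G A"
  unfolding connected_set_iff_closed_subsets using assms by (metis subset_antisym)

text \<open>The closure principle applied to \<open>A \<inter> S\<close>. It works like induction
  along \<open>A\<close>, with \<open>S\<close> an arbitrary set that need not lie inside
  \<open>A\<close>.\<close>

lemma connected_set_subset_closed:
  assumes "connected_set G A" and "A \<inter> S \<noteq> {}"
    and "\<And>x y. \<lbrakk>x \<in> A \<inter> S; y \<in> A; {x, y} \<in> uedges G\<rbrakk> \<Longrightarrow> y \<in> S"
  shows "A \<subseteq> S"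
proof -
  have "A \<inter> S = A"
    using assms unfolding connected_set_iff_closed_subsets
    by (metis IntI inf_le1)
  then show ?thesis
    by blast
qed

lemma connected_set_subset: "connected_set G A \<Longrightarrow> A \<subseteq> pverts G"
  by (simp add: connected_set_def)

lemma connected_set_nonempty: "connected_set G A \<Longrightarrow> A \<noteq> {}"
  by (simp add: connected_set_def)

lemma connected_set_singleton:
  assumes "x \<in> pverts G"
  shows "connected_set G {x}"
  using assms by (intro connected_setI) auto

lemma connected_set_edge:
  assumes "x \<in> pverts G" and "y \<in> pverts G" and "{x, y} \<in> uedges G"
  shows "connected_set G {x, y}"
  using assms by (intro connected_setI) (auto simp: insert_commute)

text \<open>An edge-closed \<open>S\<close> swallows every piece that it meets. If it meets some
  \<open>C i\<close>, it therefore reaches \<open>B\<close>, and from \<open>B\<close> it reaches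
  all the other pieces.\<close>

lemma connected_set_star_union:
  assumes B: "connected_set G B"
    and C: "\<And>i. i \<in> I \<Longrightarrow> connected_set G (C i)"
    and meet: "\<And>i. i \<in> I \<Longrightarrow> B \<inter> C i \<noteq> {}"
  shows "connected_set G (B \<union> (\<Union>i \<in> I. C i))"
proof (rule connected_setI)
  fix S
  assume S: "S \<subseteq> B \<union> (\<Union>i \<in> I. C i)" "S \<noteq> {}"
    and closed: "\<And>x y. \<lbrakk>x \<in> S; y \<in> B \<union> (\<Union>i \<in> I. C i); {x, y} \<in> uedges G\<rbrakk> \<Longrightarrow> y \<in> S"
  have C_sub: "C i \<subseteq> S" if "i \<in> I" "C i \<inter> S \<noteq> {}" for i
    by (rule connected_set_subset_closed[OF C[OF that(1)] that(2)]) (use that closed in blast)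
  have "B \<inter> S \<noteq> {}"
    using S C_sub meet by blast
  then have "B \<subseteq> S"
    by (rule connected_set_subset_closed[OF B]) (use closed in blast)
  then show "B \<union> (\<Union>i \<in> I. C i) \<subseteq> S"
    using C_sub meet by blast
qed (use B C in \<open>auto dest: connected_set_subset connected_set_nonempty\<close>)

text \<open>Connectivity passes from \<open>G\<close> to \<open>G0\<close> because adjacent vertices
  of \<open>A\<close> have overlapping regions: once an edge-closed set contains one region, it
  contains those of all neighbours in \<open>A\<close>.\<close>

lemma connected_set_UN_regions:
  assumes A: "connected_set G A"
    and R: "\<And>x. x \<in> A \<Longrightarrow> connected_set G0 (R x)"
    and meet: "\<And>x y. \<lbrakk>x \<in> A; y \<in> A; x \<noteq> y; {x, y} \<in> uedges G\<rbrakk> \<Longrightarrow> R x \<inter> R y \<noteq> {}"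
  shows "connected_set G0 (\<Union>x \<in> A. R x)"
proof (rule connected_setI)
  fix S
  assume S: "S \<subseteq> (\<Union>x \<in> A. R x)" "S \<noteq> {}"
    and closed: "\<And>p q. \<lbrakk>p \<in> S; q \<in> (\<Union>x \<in> A. R x); {p, q} \<in> uedges G0\<rbrakk> \<Longrightarrow> q \<in> S"
  have R_sub: "R x \<subseteq> S" if "x \<in> A" "R x \<inter> S \<noteq> {}" for x
    by (rule connected_set_subset_closed[OF R[OF that(1)] that(2)]) (use that closed in blast)
  have "A \<subseteq> {x. R x \<subseteq> S}"
  proof (rule connected_set_subset_closed[OF A])
    show "A \<inter> {x. R x \<subseteq> S} \<noteq> {}"
      using S R_sub by blast
    show "y \<in> {x. R x \<subseteq> S}" if "x \<in> A \<inter> {x. R x \<subseteq> S}" "y \<in> A" "{x, y} \<in> uedges G" for x y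
      using that meet[of x y] R_sub[of y] by blast
  qed
  then show "(\<Union>x \<in> A. R x) \<subseteq> S"
    by blast
next
  show "(\<Union>x \<in> A. R x) \<subseteq> pverts G0"
    using R connected_set_subset by blast
  show "(\<Union>x \<in> A. R x) \<noteq> {}"
    using connected_set_nonempty[OF A] R connected_set_nonempty by fastforce
qed

text \<open>The trimming step: \<open>P\<close> is the component of \<open>B - Y\<close> through a
  point of \<open>X\<close>. Some edge inside \<open>B\<close> must leave \<open>P\<close>, and by
  maximality of \<open>P\<close> it can only end in \<open>Y\<close>.\<close>

lemma connected_subset_adjacent:
  assumes B: "connected_set G B" and X: "B \<inter> X \<noteq> {}" and Y: "B \<inter> Y \<noteq> {}" and disj: "X \<inter> Y = {}"
  obtains P where "connected_set G P" and "P \<subseteq> B - Y" and "P \<inter> X \<noteq> {}"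
    and "uedges_between G P Y \<noteq> {}"
proof -
  obtain p where p: "p \<in> B" "p \<in> X" "p \<notin> Y"
    using X disj by blast
  define \<C> where "\<C> = {C. connected_set G C \<and> p \<in> C \<and> C \<subseteq> B - Y}"
  \<comment> \<open>Writing \<open>{p}\<close> separately makes this union a star centred at
    \<open>p\<close>, so that its connectivity is an instance of
    \<open>connected_set_star_union\<close>.\<close>
  define P where "P = {p} \<union> (\<Union>C \<in> \<C>. C)"
  have V: "B \<subseteq> pverts G"
    using B by (rule connected_set_subset)
  have P_conn: "connected_set G P"
    unfolding P_def
    by (rule connected_set_star_union[OF connected_set_singleton])
       (use p V in \<open>auto simp: \<C>_def\<close>)
  have P_sub: "P \<subseteq> B - Y"
    using p by (auto simp: P_def \<C>_def)
  have "\<not> B \<subseteq> P"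
    using P_sub Y by blast
  moreover have "B \<inter> P \<noteq> {}"
    using p by (auto simp: P_def)
  ultimately obtain x y where xy: "x \<in> P" "y \<in> B" "{x, y} \<in> uedges G" "y \<notin> P"
    using connected_set_subset_closed[OF B, of P] by blast
  have "y \<in> Y"
  proof (rule ccontr)
    assume "y \<notin> Y"
    \<comment> \<open>A star with the single ray \<open>{x, y}\<close>, which meets \<open>P\<close>
      in \<open>x\<close>.\<close>
    have "connected_set G (P \<union> (\<Union>i \<in> {()}. {x, y}))"
      by (rule connected_set_star_union[OF P_conn connected_set_edge]) (use xy P_sub V in auto)
    then have "insert y P \<in> \<C>"
      using xy P_sub \<open>y \<notin> Y\<close> by (auto simp: \<C>_def P_def insert_absorb)
    then show False
      using \<open>y \<notin> P\<close> by (auto simp: P_def)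
  qed
  then have "uedges_between G P Y \<noteq> {}"
    using xy by (auto simp: uedges_between_def)
  then show thesis
    using that P_conn P_sub p by (auto simp: P_def)
qed

lemma uedges_subdivide_edges_iff:
  "{Inl u, Inl v} \<notin> uedges (subdivide_edges H)"
  "{Inr e, Inr f} \<notin> uedges (subdivide_edges H)"
  "{Inl u, Inr e} \<in> uedges (subdivide_edges H) \<longleftrightarrow> e \<in> uedges H \<and> u \<in> e"
  unfolding doubleton_in_uedges_iff by (auto simp: subdivide_edges_def)

theorem lemma1p5:
  fixes G0 :: "'a pair_pre_digraph"
    and G :: "'b pair_pre_digraph"
    and H :: "'c pair_pre_digraph"
  assumes "pair_graph G0" and "pair_graph G" and "pair_graph H"
    and "region_intersection_graph G G0"
    and "is_strict_minor (subdivide_edges H) G"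
  shows "is_minor H G0"
proof -
  interpret H: pair_graph H
    by (rule assms)
  let ?S = "subdivide_edges H"
  obtain R where R: "\<forall>x \<in> pverts G. connected_set G0 (R x)"
    and R_meet: "\<forall>x \<in> pverts G. \<forall>y \<in> pverts G. x \<noteq> y \<longrightarrow>
      ({x, y} \<in> uedges G \<longleftrightarrow> R x \<inter> R y \<noteq> {})"
    using assms(4) unfolding region_intersection_graph_def by (elim exE conjE) (rule that)
  obtain A where A: "\<forall>s \<in> pverts ?S. connected_set G (A s)"
    and A_disj: "\<forall>s \<in> pverts ?S. \<forall>t \<in> pverts ?S. s \<noteq> t \<longrightarrow> A s \<inter> A t = {}"
    and A_adj: "\<forall>s \<in> pverts ?S. \<forall>t \<in> pverts ?S. s \<noteq> t \<longrightarrow>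
      ({s, t} \<in> uedges ?S \<longleftrightarrow> uedges_between G (A s) (A t) \<noteq> {})"
    using assms(5) unfolding is_strict_minor_def by (elim exE conjE) (rule that)
  have A_sub: "A s \<subseteq> pverts G" if "s \<in> pverts ?S" for s
    using A that connected_set_subset by blast
  define B where "B s = (\<Union>x \<in> A s. R x)" for s
  have B: "connected_set G0 (B s)" if "s \<in> pverts ?S" for s
    unfolding B_def
  proof (rule connected_set_UN_regions)
    show "connected_set G (A s)"
      using A that by blast
    show "connected_set G0 (R x)" if "x \<in> A s" for x
      using R A_sub[OF \<open>s \<in> pverts ?S\<close>] that by blast
    show "R x \<inter> R y \<noteq> {}" if "x \<in> A s" "y \<in> A s" "x \<noteq> y" "{x, y} \<in> uedges G" for x y
      using R_meet A_sub[OF \<open>s \<in> pverts ?S\<close>] that by (metis subsetD)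
  qed
  have B_meet: "B s \<inter> B t \<noteq> {} \<longleftrightarrow> {s, t} \<in> uedges ?S"
    if st: "s \<in> pverts ?S" "t \<in> pverts ?S" "s \<noteq> t" for s t
  proof -
    have "R x \<inter> R y \<noteq> {} \<longleftrightarrow> {x, y} \<in> uedges G" if "x \<in> A s" "y \<in> A t" for x y
    proof -
      have "x \<in> pverts G" "y \<in> pverts G"
        using A_sub st that by blast+
      \<comment> \<open>The rig condition speaks only of distinct vertices; disjointness of the
        branch sets provides this.\<close>
      moreover have "x \<noteq> y"
        using A_disj st that by (metis IntI empty_iff)
      ultimately show ?thesis
        using R_meet by metis
    qed
    then have "B s \<inter> B t \<noteq> {} \<longleftrightarrow> uedges_between G (A s) (A t) \<noteq> {}"
      by (auto simp: B_def uedges_between_def)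
    then show ?thesis
      using A_adj st by metis
  qed
  have verts: "Inl u \<in> pverts ?S \<longleftrightarrow> u \<in> pverts H" "Inr e \<in> pverts ?S \<longleftrightarrow> e \<in> uedges H" for u e
    by (auto simp: subdivide_edges_def)
  have B_Inl: "B (Inl u) \<inter> B (Inl v) = {}" if "u \<in> pverts H" "v \<in> pverts H" "u \<noteq> v" for u v
    using B_meet[of "Inl u" "Inl v"] that by (simp add: verts uedges_subdivide_edges_iff)
  have B_Inr: "B (Inr e) \<inter> B (Inr f) = {}" if "e \<in> uedges H" "f \<in> uedges H" "e \<noteq> f" for e f
    using B_meet[of "Inr e" "Inr f"] that by (simp add: verts uedges_subdivide_edges_iff)
  have B_Inl_Inr: "B (Inl u) \<inter> B (Inr e) \<noteq> {} \<longleftrightarrow> u \<in> e" if "u \<in> pverts H" "e \<in> uedges H" for u e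
    using B_meet[of "Inl u" "Inr e"] that by (simp add: verts uedges_subdivide_edges_iff)

  have "\<exists>u v P. e = {u, v} \<and> u \<in> pverts H \<and> v \<in> pverts H \<and> u \<noteq> v \<and> connected_set G0 P \<and>
      P \<subseteq> B (Inr e) - B (Inl v) \<and> P \<inter> B (Inl u) \<noteq> {} \<and> uedges_between G0 P (B (Inl v)) \<noteq> {}"
    if e: "e \<in> uedges H" for e
  proof -
    obtain u v where uv: "e = {u, v}" "(u, v) \<in> parcs H"
      using e by (auto simp: uedges_def)
    then have "u \<in> pverts H" "v \<in> pverts H" "u \<noteq> v"
      using H.wellformed'[OF uv(2)] H.no_loops' by auto
    moreover have "B (Inr e) \<inter> B (Inl u) \<noteq> {}" "B (Inr e) \<inter> B (Inl v) \<noteq> {}"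
      using B_Inl_Inr[OF \<open>u \<in> pverts H\<close> e] B_Inl_Inr[OF \<open>v \<in> pverts H\<close> e] uv by auto
    ultimately show ?thesis
      using connected_subset_adjacent[OF B, of "Inr e" "B (Inl u)" "B (Inl v)"] e B_Inl uv(1) verts
      by metis
  qed
  \<comment> \<open>Choice fixes one orientation for each undirected edge: \<open>a e\<close> is the
    end that will absorb the piece \<open>P e\<close>, and \<open>b e\<close> is the end to which
    that piece is adjacent.\<close>
  then obtain a b P where e: "\<And>e. e \<in> uedges H \<Longrightarrow> e = {a e, b e} \<and> a e \<in> pverts H \<and> b e \<in> pverts H \<and> a e \<noteq> b e"
    and P: "\<And>e. e \<in> uedges H \<Longrightarrow> connected_set G0 (P e)"
    and P_sub: "\<And>e. e \<in> uedges H \<Longrightarrow> P e \<subseteq> B (Inr e) - B (Inl (b e))"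
    and P_meet: "\<And>e. e \<in> uedges H \<Longrightarrow> P e \<inter> B (Inl (a e)) \<noteq> {}"
    and P_adj: "\<And>e. e \<in> uedges H \<Longrightarrow> uedges_between G0 (P e) (B (Inl (b e))) \<noteq> {}"
    by metis
  \<comment> \<open>For \<open>w = b e\<close> this is the trimming; any other \<open>w\<close> lies
    outside \<open>e\<close>, so already the whole of \<open>B (Inr e)\<close> misses
    \<open>B (Inl w)\<close>.\<close>
  have P_B: "P e \<inter> B (Inl w) = {}" if "e \<in> uedges H" "w \<in> pverts H" "w \<noteq> a e" for e w
    using that e[of e] P_sub[of e] B_Inl_Inr[of w e] by (cases "w = b e") blast+
  have P_P: "P e \<inter> P f = {}" if "e \<in> uedges H" "f \<in> uedges H" "e \<noteq> f" for e f
    using that P_sub B_Inr by blast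
  define M where "M u = B (Inl u) \<union> (\<Union>e \<in> {e \<in> uedges H. a e = u}. P e)" for u
  have "connected_set G0 (M u)" if "u \<in> pverts H" for u
    unfolding M_def
    by (rule connected_set_star_union) (use that B P P_meet in \<open>auto simp: verts\<close>)
  \<comment> \<open>Pieces absorbed by different vertices come from different edges, since
    \<open>a\<close> is a function; hence \<open>P_P\<close> applies to them.\<close>
  moreover have "M u \<inter> M v = {}" if uv: "u \<in> pverts H" "v \<in> pverts H" "u \<noteq> v" for u v
    using B_Inl[OF uv] P_B P_P uv unfolding M_def by blast
  moreover have "uedges_between G0 (M u) (M v) \<noteq> {}" if "{u, v} \<in> uedges H" for u v
  proof -
    have mono: "uedges_between G0 (P f) (B (Inl (b f))) \<subseteq> uedges_between G0 (M (a f)) (M (b f))"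
      if "f \<in> uedges H" for f
      using that unfolding uedges_between_def M_def by blast
    have comm: "uedges_between G0 X Y = uedges_between G0 Y X" for X Y
      unfolding uedges_between_def by (metis insert_commute)
    have "uedges_between G0 (M (a {u, v})) (M (b {u, v})) \<noteq> {}"
      using mono P_adj that by blast
    \<comment> \<open>The chosen orientation may be opposite to the order of \<open>u\<close> and
      \<open>v\<close>; \<open>comm\<close> covers that case.\<close>
    moreover have "a {u, v} = u \<and> b {u, v} = v \<or> a {u, v} = v \<and> b {u, v} = u"
      using e[OF that] by (auto simp: doubleton_eq_iff)
    ultimately show ?thesis
      using comm by metis
  qed
  ultimately show ?thesis
    unfolding is_minor_def by blast
qed

end
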